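(* Let $\ell_1\ge1$ and $1\le \ell_2\le k_2$ be integers, let $p\in[0,1]$, $q=1-p$, and put $a(p)=q^{\ell_1}p^{\ell_2}$, $\ell=\ell_1+\ell_2$, $m_2=k_2-\ell_2+1$. Let $H^n_{\ell_1,\ell_2,k_2}$ be the number of occurrences, in $n$ independent Bernoulli($p$) trials, of at least $\ell_1$ consecutive 0's followed by at least $\ell_2$ and at most $k_2$ consecutive 1's, and let $\phi_n(t)$, $p_{m,n}$, $\mu_{n,j}$ be its probability generating function, probability mass function and $j$-th non-central moment. Write $\mathbf 1(\cdot)$ for the indicator. Then, for all $n\ge \ell+1$: (i) $\phi_n(t)=\phi_{n-1}(t)+a(p)(t-1)\left[\phi_{n-\ell}(t)-p^{m_2}\phi_{n-\ell-m_2}(t)\right]-a(p)(t-1)p^{n-\ell}\,\mathbf 1(\ell+1\le n\le \ell+m_2-1)$, with initial conditions $\phi_n(t)=1$ for $0\le n\le \ell$ (and $\phi_n(t)=0$ for $n<0$). (ii) For every integer $m\ge0$, $$\begin{aligned}p_{m,n}&=p_{m,n-1}+a(p)\left[p_{m-1,n-\ell}-p_{m,n-\ell}-p^{m_2}(p_{m-1,n-\ell-m_2}-p_{m,n-\ell-m_2})\right]\\&\quad-a(p)\,p^{n-\ell}\left[\mathbf 1(m=1,\ \ell+1\le n\le \ell+m_2-1)-\mathbf 1(m=0,\ \ell+1\le n\le \ell+m_2-1)\right],\end{aligned}$$ with initial conditions $p_{0,n}=1$ and $p_{m,n}=0$ for $m>0$, when $0\le n\le \ell$ (and $p_{m,n}=0$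 if $n<0$ or $m<0$). (iii) For every integer $j\ge1$, $$\mu_{n,j}=\mu_{n-1,j}+a(p)\sum_{k=0}^{j-1}\binom{j}{k}\left[\mu_{n-\ell,k}-p^{m_2}\mu_{n-\ell-m_2,k}\right]-a(p)\,p^{n-\ell}\,\mathbf 1(\ell+1\le n\le \ell+m_2-1),$$ with initial conditions $\mu_{n,0}=1$ for $n\ge0$, $\mu_{n,j}=0$ for all $j\ge1$ and $0\le n\le \ell$ (and $\mu_{n,j}=0$ for all $j\ge0$ if $n<0$).
   Context: Let $\zeta_1,\zeta_2,\dots$ be independent with $P(\zeta_i=1)=p$ and $P(\zeta_i=0)=q=1-p$. $H^n_{\ell_1,\ell_2,k_2}$ is the number of occurrences of the following pattern within $\zeta_1,\dots,\zeta_n$: at least $\ell_1$ consecutive 0's, immediately followed by exactly $i$ consecutive 1's for some $\ell_2\le i\le k_2$, immediately followed by a 0, where this terminating 0 is at a position $\le n$. (The pattern is counted only when the terminating 0 occurs, so a final block of 1's not yet ended by a 0 within the first $n$ trials is not counted.) Equivalently, $H^n_{\ell_1,\ell_2,k_2}$ is the number of positions $m\ge1$ for which there is $t\in\{0,\dots,k_2-\ell_2\}$ with $m+t+\ell_1+\ell_2\le n$, $\zeta_m=\dots=\zeta_{m+\ell_1-1}=0$, $\zeta_{m+\ell_1}=\dots=\zeta_{m+\ell_1+\ell_2+t-1}=1$ and $\zeta_{m+\ell_1+\ell_2+t}=0$. For example, for the sequence 00111101100010100011 of length 20, $H^{20}_{1,1,2}=3$, $H^{20}_{3,1,2}=1$,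 $H^{20}_{2,2,2}=0$, $H^{20}_{1,4,4}=1$. For $n\ge0$: $\phi_n(t)=E\big[t^{H^n_{\ell_1,\ell_2,k_2}}\big]$, $p_{m,n}=P(H^n_{\ell_1,\ell_2,k_2}=m)$, $\mu_{n,j}=E\big[(H^n_{\ell_1,\ell_2,k_2})^j\big]$ (with $0^0=1$, so $\mu_{n,0}=1$). Quantities with a negative time index $n$ are set equal to $0$. *)

theory Defs
  imports "HOL-Probability.Probability"
begin

text \<open>
  Trials are indexed from 1; the value at index 0 is ignored.
  An occurrence is identified by the start \<open>m\<close> of the last \<open>l1\<close> zeros before the block of
  ones, so longer zero runs are counted once. The block of ones has length \<open>l2 + t\<close> and is
  exact, being enclosed by zeros (\<open>l1 \<ge> 1\<close>); the closing zero must lie within the first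
  \<open>n\<close> trials.
\<close>

definition pattern_count :: "nat \<Rightarrow> nat \<Rightarrow> nat \<Rightarrow> (nat \<Rightarrow> nat) \<Rightarrow> nat \<Rightarrow> nat" where
  "pattern_count l1 l2 k2 x n =
     card {m. 1 \<le> m \<and>
       (\<exists>t\<in>{0..k2 - l2}. m + t + l1 + l2 \<le> n \<and>
          (\<forall>i\<in>{m..<m + l1}. x i = 0) \<and>
          (\<forall>i\<in>{m + l1..<m + l1 + l2 + t}. x i = 1) \<and>
          x (m + l1 + l2 + t) = 0)}"

text \<open>The time index is an integer; all three quantities vanish at negative times.\<close>

definition pattern_pgf ::
    "'a measure \<Rightarrow> (nat \<Rightarrow> 'a \<Rightarrow> nat) \<Rightarrow> nat \<Rightarrow> nat \<Rightarrow> nat \<Rightarrow> int \<Rightarrow> real \<Rightarrow> real" where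
  "pattern_pgf M \<zeta> l1 l2 k2 n t =
     (if n < 0 then 0
      else \<integral>\<omega>. t ^ pattern_count l1 l2 k2 (\<lambda>i. \<zeta> i \<omega>) (nat n) \<partial>M)"

definition pattern_prob ::
    "'a measure \<Rightarrow> (nat \<Rightarrow> 'a \<Rightarrow> nat) \<Rightarrow> nat \<Rightarrow> nat \<Rightarrow> nat \<Rightarrow> int \<Rightarrow> int \<Rightarrow> real" where
  "pattern_prob M \<zeta> l1 l2 k2 m n =
     (if n < 0 then 0
      else measure M {\<omega> \<in> space M. int (pattern_count l1 l2 k2 (\<lambda>i. \<zeta> i \<omega>) (nat n)) = m})"

definition pattern_moment ::
    "'a measure \<Rightarrow> (nat \<Rightarrow> 'a \<Rightarrow> nat) \<Rightarrow> nat \<Rightarrow> nat \<Rightarrow> nat \<Rightarrow> int \<Rightarrow> nat \<Rightarrow> real" where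
  "pattern_moment M \<zeta> l1 l2 k2 n j =
     (if n < 0 then 0
      else \<integral>\<omega>. real (pattern_count l1 l2 k2 (\<lambda>i. \<zeta> i \<omega>) (nat n)) ^ j \<partial>M)"

end

theory Submission
  imports Defs
begin

text \<open>
  Let \<open>C n\<close> be the number of patterns among the first \<open>n\<close> trials. At most one pattern is completed
  at time \<open>n\<close>; if it starts at \<open>m\<close>, then \<open>C (n - 1) = C m\<close>, because the trials after \<open>m\<close> are
  zeros followed by ones. Hence, for every \<open>f\<close> with difference \<open>\<Delta>\<close>, the difference
  \<open>E f(C n) - E f(C (n - 1))\<close> is the sum of \<open>a p^t E[\<Delta>(C m); trial m is 0]\<close> over the admissible
  lengths \<open>l2 + t\<close> of the block of ones, where \<open>m = n - L - t \<ge> 1\<close>; of the \<open>l1 + 1\<close> zeros of the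
  pattern, \<open>l1\<close> lie after \<open>m\<close>, which gives the factor \<open>q^l1\<close> in \<open>a\<close>. Since a nonzero trial does not change the count,
  \<open>E[\<Delta>(C m); trial m is 0] = E \<Delta>(C m) - p E \<Delta>(C (m - 1))\<close>, and the sum telescopes. It is cut
  off at \<open>m = 1\<close> when \<open>n < L + m2\<close>, which yields the indicator term. The three recurrences are
  the cases where \<open>f\<close> is a geometric sequence, a point indicator and a power.
\<close>

section \<open>Occurrences with a given start and end\<close>

text \<open>Carrying both the start \<open>m\<close> and the end \<open>e\<close> lets occurrences
  be compared by a common end or by a common start.\<close>

definition pattern_at :: "nat \<Rightarrow> nat \<Rightarrow> (nat \<Rightarrow> nat) \<Rightarrow> nat \<Rightarrow> nat \<Rightarrow> bool" where
  "pattern_at l1 r x m e \<longleftrightarrow> 1 \<le> m \<and> m + l1 + r = e \<and>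
     (\<forall>i\<in>{m..<m + l1}. x i = 0) \<and> (\<forall>i\<in>{m + l1..<e}. x i = 1) \<and> x e = 0"

text \<open>With the end fixed, the shorter block of ones is preceded by a zero at a position that
  the longer block fills with a one. The length then fixes the start.\<close>

lemma pattern_at_unique_start:
  assumes "pattern_at l1 r x m e" "pattern_at l1 r' x m' e" "1 \<le> l1"
  shows "r = r'"
proof -
  have *: "\<not> r < r'" if P: "pattern_at l1 r x m e" "pattern_at l1 r' x m' e" for r r' m m'
  proof
    assume "r < r'"
    then have "m + l1 - 1 \<in> {m..<m + l1}" "m + l1 - 1 \<in> {m' + l1..<e}"
      using P(1,2)[unfolded pattern_at_def, THEN conjunct2, THEN conjunct1] \<open>1 \<le> l1\<close>
      by auto
    then have "x (m + l1 - 1) = 0" "x (m + l1 - 1) = 1"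
      using P unfolding pattern_at_def by blast+
    then show False by simp
  qed
  show ?thesis using *[of r m r' m'] *[of r' m' r m] assms by auto
qed

text \<open>With the start fixed, both blocks of ones begin at the same position, so the earlier
  closing zero would lie inside the later block.\<close>

lemma pattern_at_unique_end:
  assumes "pattern_at l1 r x m e" "pattern_at l1 r' x m e'"
  shows "e = e'"
proof -
  have *: "\<not> e < e'" if P: "pattern_at l1 r x m e" "pattern_at l1 r' x m e'" for r r' e e'
  proof
    assume "e < e'"
    then have "e \<in> {m + l1..<e'}"
      using P by (auto simp: pattern_at_def)
    then have "x e = 0" "x e = 1"
      using P unfolding pattern_at_def by blast+
    then show False by simp
  qed
  show ?thesis using *[of r e r' e'] *[of r' e' r e] assms by auto
qed

lemma pattern_at_endD:
  assumes "pattern_at l1 r x m e" "1 \<le> r"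
  shows "x e = 0" "x (e - 1) = 1"
proof -
  have "e - 1 \<in> {m + l1..<e}" using assms by (auto simp: pattern_at_def)
  then show "x e = 0" "x (e - 1) = 1" using assms unfolding pattern_at_def by blast+
qed

section \<open>Growth of the number of occurrences\<close>

lemma pattern_count_eq:
  "pattern_count l1 l2 k2 x n = card {m. \<exists>e\<le>n. \<exists>t\<le>k2 - l2. pattern_at l1 (l2 + t) x m e}"
  unfolding pattern_count_def pattern_at_def
  by (rule arg_cong[of _ _ card], auto simp: add_ac)

lemma finite_pattern_starts: "finite {m. \<exists>e\<le>n. \<exists>t\<le>k. pattern_at l1 (l2 + t) x m e}"
  by (rule finite_subset[of _ "{..n}"]) (auto simp: pattern_at_def)

text \<open>By uniqueness of the length, the starts of occurrences ending at \<open>Suc n\<close>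
  form at most a singleton; by uniqueness of the end, none of them was counted before.\<close>

lemma pattern_count_Suc:
  assumes "1 \<le> l1"
  shows "pattern_count l1 l2 k2 x (Suc n) =
    pattern_count l1 l2 k2 x n + of_bool (\<exists>t\<le>k2 - l2. \<exists>m. pattern_at l1 (l2 + t) x m (Suc n))"
proof -
  let ?S = "{m. \<exists>e\<le>n. \<exists>t\<le>k2 - l2. pattern_at l1 (l2 + t) x m e}"
  let ?T = "{m. \<exists>t\<le>k2 - l2. pattern_at l1 (l2 + t) x m (Suc n)}"
  have "?T = {} \<or> (\<exists>m. ?T = {m})"
  proof (cases "?T = {}")
    case False
    then obtain m t where m: "pattern_at l1 (l2 + t) x m (Suc n)" "t \<le> k2 - l2" by auto
    have "m' = m" if "pattern_at l1 (l2 + t') x m' (Suc n)" for m' t'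
      using pattern_at_unique_start[OF m(1) that assms] m(1) that by (auto simp: pattern_at_def)
    with m have "?T = {m}" by blast
    then show ?thesis by blast
  qed simp
  then have "card ?T = of_bool (?T \<noteq> {})" by auto
  moreover have "?S \<inter> ?T = {}"
  proof -
    have False if "e \<le> n" "pattern_at l1 r x m e" "pattern_at l1 r' x m (Suc n)" for e r r' m
      using pattern_at_unique_end[OF that(2,3)] that(1) by simp
    then show ?thesis by blast
  qed
  moreover have "{m. \<exists>e\<le>Suc n. \<exists>t\<le>k2 - l2. pattern_at l1 (l2 + t) x m e} = ?S \<union> ?T"
    by (auto simp: le_Suc_eq)
  moreover have "finite ?T"
    by (rule finite_subset[of _ "{..Suc n}"]) (auto simp: pattern_at_def)
  moreover have "finite ?S" by (rule finite_pattern_starts)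
  ultimately show ?thesis
    unfolding pattern_count_eq by (simp add: card_Un_disjoint)
qed

text \<open>The shortest occurrence, closing zero included, takes \<open>l1 + l2 + 1\<close>
  trials.\<close>

lemma pattern_count_eq_0: "n \<le> l1 + l2 \<Longrightarrow> pattern_count l1 l2 k2 x n = 0"
  unfolding pattern_count_def card_eq_0_iff by force

lemma pattern_count_le: "pattern_count l1 l2 k2 x n \<le> n"
proof -
  have "pattern_count l1 l2 k2 x n \<le> card {1..n}"
    unfolding pattern_count_def by (intro card_mono) auto
  then show ?thesis by simp
qed

lemma pattern_count_cong:
  assumes "\<And>i. i \<in> {1..n} \<Longrightarrow> x i = y i"
  shows "pattern_count l1 l2 k2 x n = pattern_count l1 l2 k2 y n"
proof -
  have *: "pattern_at l1 r x m e \<longleftrightarrow> pattern_at l1 r y m e" if "e \<le> n" for r m e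
    unfolding pattern_at_def
    by (intro conj_cong refl ball_cong) (use assms that in auto)
  show ?thesis unfolding pattern_count_eq
    by (intro arg_cong[of _ _ card] Collect_cong ex_cong1 conj_cong refl) (simp add: *)
qed

text \<open>Since \<open>1 \<le> l2\<close>, every occurrence ends with a one followed by a zero;
  without such a descent after \<open>m\<close>, nothing is completed there.\<close>

lemma pattern_count_constant:
  assumes "1 \<le> l1" "1 \<le> l2" "m \<le> n"
    and "\<And>e. m < e \<Longrightarrow> e \<le> n \<Longrightarrow> x e = 0 \<Longrightarrow> x (e - 1) \<noteq> 1"
  shows "pattern_count l1 l2 k2 x n = pattern_count l1 l2 k2 x m"
  using assms(3,4)
proof (induction n rule: dec_induct)
  case base
  show ?case by (rule refl)
next
  case (step n)
  note no_end = step.prems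
  have "\<not> pattern_at l1 (l2 + t) x m' (Suc n)" for t m'
  proof
    assume at: "pattern_at l1 (l2 + t) x m' (Suc n)"
    have "1 \<le> l2 + t" using assms(2) by (rule trans_le_add1)
    note ends = pattern_at_endD[OF at this]
    have "m < Suc n" using step.hyps(1) by (rule le_imp_less_Suc)
    from no_end[OF this order_refl ends(1)] ends(2) show False by (rule notE)
  qed
  then have "pattern_count l1 l2 k2 x (Suc n) = pattern_count l1 l2 k2 x n"
    unfolding pattern_count_Suc[OF assms(1)] by simp
  also have "\<dots> = pattern_count l1 l2 k2 x m"
  proof (rule step.IH)
    fix e assume "m < e" "e \<le> n" "x e = 0"
    then show "x (e - 1) \<noteq> 1" by (intro no_end le_SucI)
  qed
  finally show ?case .
qed

text \<open>The comparison goes back to \<open>m\<close> and not to \<open>m - 1\<close>, since the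
  zero at \<open>m\<close> may itself close an earlier occurrence.\<close>

lemma pattern_count_before:
  assumes "1 \<le> l1" "1 \<le> l2" "pattern_at l1 r x m (Suc n)"
  shows "pattern_count l1 l2 k2 x n = pattern_count l1 l2 k2 x m"
proof (rule pattern_count_constant[OF assms(1,2)])
  show "m \<le> n" using assms by (auto simp: pattern_at_def)
next
  fix e assume e: "m < e" "e \<le> n" "x e = 0"
  have "e \<notin> {m + l1..<Suc n}" using e assms(3) unfolding pattern_at_def by force
  \<comment> \<open>As \<open>m < e\<close>, the predecessor of \<open>e\<close> still belongs to
    the opening zeros.\<close>
  then have "e - 1 \<in> {m..<m + l1}" using e by auto
  then show "x (e - 1) \<noteq> 1" using assms(3) unfolding pattern_at_def by force
qed

text \<open>The length \<open>l2 + t\<close> determines the start of an occurrence ending at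
  \<open>Suc n\<close>, and \<open>t + l1 + l2 \<le> n\<close> says that this start is at least 1.
  The count just before completion is replaced by the count at the start, which no longer involves
  the later trials of the pattern.\<close>

lemma pattern_count_increment:
  fixes f :: "nat \<Rightarrow> real"
  assumes "1 \<le> l1" "1 \<le> l2"
  shows "f (pattern_count l1 l2 k2 x (Suc n)) - f (pattern_count l1 l2 k2 x n) =
    (\<Sum>t | t \<le> k2 - l2 \<and> t + l1 + l2 \<le> n.
       of_bool (pattern_at l1 (l2 + t) x (Suc n - l1 - l2 - t) (Suc n)) *
       (f (pattern_count l1 l2 k2 x (Suc n - l1 - l2 - t) + 1) -
        f (pattern_count l1 l2 k2 x (Suc n - l1 - l2 - t))))"
    (is "_ = (\<Sum>t\<in>?T. ?g t)")
proof (cases "\<exists>t\<le>k2 - l2. \<exists>m. pattern_at l1 (l2 + t) x m (Suc n)")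
  case True
  then obtain t m where t: "t \<le> k2 - l2" "pattern_at l1 (l2 + t) x m (Suc n)" by blast
  then have m: "m = Suc n - l1 - l2 - t" and "t \<in> ?T" by (auto simp: pattern_at_def)
  have "finite ?T" by simp
  have sum_singleton: "(\<Sum>t'\<in>{t}. g t') = g t" for g :: "nat \<Rightarrow> real" by simp
  \<comment> \<open>Two lengths cannot share the end \<open>Suc n\<close>, so only the summand for
    \<open>t\<close> survives.\<close>
  have "(\<Sum>t\<in>?T. ?g t) = (\<Sum>t'\<in>{t}. ?g t')"
  proof (rule sum.mono_neutral_right)
    show "\<forall>i\<in>?T - {t}. ?g i = 0"
    proof
      fix t' assume "t' \<in> ?T - {t}"
      then have "l2 + t \<noteq> l2 + t'" by simp
      then have "\<not> pattern_at l1 (l2 + t') x (Suc n - l1 - l2 - t') (Suc n)"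
        using pattern_at_unique_start[OF t(2) _ assms(1)] by blast
      then show "?g t' = 0" by simp
    qed
  qed (use \<open>finite ?T\<close> \<open>t \<in> ?T\<close> in blast)+
  also have "\<dots> = ?g t"
    by (rule sum_singleton)
  also have "\<dots> = f (pattern_count l1 l2 k2 x m + 1) - f (pattern_count l1 l2 k2 x m)"
    using t(2) unfolding m[symmetric] by simp
  also have "\<dots> = f (pattern_count l1 l2 k2 x n + 1) - f (pattern_count l1 l2 k2 x n)"
    unfolding pattern_count_before[OF assms t(2)] ..
  also have "pattern_count l1 l2 k2 x n + 1 = pattern_count l1 l2 k2 x (Suc n)"
    unfolding pattern_count_Suc[OF assms(1)] using True by simp
  finally show ?thesis by (rule sym)
next
  case False
  then have "(\<Sum>t\<in>?T. ?g t) = 0"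
    by (intro sum.neutral) auto
  moreover have "pattern_count l1 l2 k2 x (Suc n) = pattern_count l1 l2 k2 x n"
    unfolding pattern_count_Suc[OF assms(1)] using False by simp
  ultimately show ?thesis by simp
qed

section \<open>Bounded functions of finitely many trials\<close>

text \<open>For functions of the whole sequence, this replaces measurability with respect to the
  first \<open>s\<close> trials; the bound secures integrability.\<close>

definition bounded_past :: "nat \<Rightarrow> ((nat \<Rightarrow> nat) \<Rightarrow> real) \<Rightarrow> bool" where
  "bounded_past s h \<longleftrightarrow>
     (\<forall>x y. (\<forall>i\<in>{1..s}. x i = y i) \<longrightarrow> h x = h y) \<and> (\<exists>B. \<forall>x. \<bar>h x\<bar> \<le> B)"

lemma bounded_past_of_bool_mult:
  assumes "bounded_past s h" "s \<le> s'"
    and "\<And>x y. (\<And>i. i \<in> {1..s'} \<Longrightarrow> x i = y i) \<Longrightarrow> Q x = Q y"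
  shows "bounded_past s' (\<lambda>x. h x * of_bool (Q x))"
proof -
  from assms(1) obtain B where B: "\<bar>h x\<bar> \<le> B" for x by (auto simp: bounded_past_def)
  have "\<bar>h x * of_bool (Q x)\<bar> \<le> B" for x
    using B[of x] by (cases "Q x") auto
  moreover have "h x * of_bool (Q x) = h y * of_bool (Q y)" if "\<forall>i\<in>{1..s'}. x i = y i" for x y
  proof -
    have "h x = h y" using assms(1,2) that unfolding bounded_past_def by auto
    then show ?thesis using assms(3)[of x y] that by auto
  qed
  ultimately show ?thesis unfolding bounded_past_def by blast
qed

text \<open>The count lies in \<open>{0..n}\<close>, so the sum of the absolute values of
  \<open>f\<close> there is a bound, however fast \<open>f\<close> grows.\<close>

lemma bounded_past_pattern_count: "bounded_past n (\<lambda>x. f (pattern_count l1 l2 k2 x n))"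
proof -
  have "\<bar>f (pattern_count l1 l2 k2 x n)\<bar> \<le> (\<Sum>k\<le>n. \<bar>f k\<bar>)" for x
    by (rule member_le_sum) (auto intro: pattern_count_le)
  moreover have "f (pattern_count l1 l2 k2 x n) = f (pattern_count l1 l2 k2 y n)"
    if "\<forall>i\<in>{1..n}. x i = y i" for x y
    using pattern_count_cong[of n x y] that by simp
  ultimately show ?thesis unfolding bounded_past_def by blast
qed

lemma bounded_past_restrict:
  assumes "bounded_past s h"
  shows "h (restrict x {1..s}) = h x"
  using assms unfolding bounded_past_def by (metis restrict_apply')

text \<open>A finite product of countable discrete spaces is again discrete.\<close>

lemma measurable_PiM_nat:
  fixes h :: "(nat \<Rightarrow> nat) \<Rightarrow> real"
  assumes "finite I"
  shows "h \<in> borel_measurable (PiM I (\<lambda>_. count_space UNIV))"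
  using assms by (subst count_space_PiM_finite) (auto intro: countable_subset)

text \<open>With \<open>E t = p ^ t * D (N - t)\<close>, each summand is
  \<open>E t - E (t + 1)\<close>.\<close>

lemma sum_power_telescope:
  fixes D :: "nat \<Rightarrow> real" and p :: real
  assumes "r \<le> N"
  shows "(\<Sum>t<r. p ^ t * (D (N - t) - p * D (N - t - 1))) = D N - p ^ r * D (N - r)"
  using assms
proof (induction r)
  case (Suc r)
  have "N - r - 1 = N - Suc r" by simp
  with Suc show ?case by (simp only: sum.lessThan_Suc) (simp add: right_diff_distrib mult_ac)
qed simp

section \<open>Expectations over independent trials\<close>

locale bernoulli_trials = prob_space M for M :: "'a measure" +
  fixes \<zeta> :: "nat \<Rightarrow> 'a \<Rightarrow> nat" and p q :: real
  assumes indep: "indep_vars (\<lambda>_. count_space UNIV) \<zeta> {1..}"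
    and prob_1: "i \<ge> 1 \<Longrightarrow> prob {\<omega> \<in> space M. \<zeta> i \<omega> = 1} = p"
    and prob_0: "i \<ge> 1 \<Longrightarrow> prob {\<omega> \<in> space M. \<zeta> i \<omega> = 0} = q"
    and q_eq: "q = 1 - p"
begin

abbreviation seq :: "'a \<Rightarrow> nat \<Rightarrow> nat" where
  "seq \<omega> \<equiv> (\<lambda>i. \<zeta> i \<omega>)"

lemma trial_measurable: "i \<ge> 1 \<Longrightarrow> \<zeta> i \<in> measurable M (count_space UNIV)"
  using indep unfolding indep_vars_def by auto

lemma bounded_past_integrable:
  assumes "bounded_past s h"
  shows "integrable M (\<lambda>\<omega>. h (seq \<omega>))"
proof -
  obtain B where B: "\<bar>h x\<bar> \<le> B" for x using assms by (auto simp: bounded_past_def)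
  have "(\<lambda>\<omega>. restrict (seq \<omega>) {1..s}) \<in> measurable M (PiM {1..s} (\<lambda>_. count_space UNIV))"
    by (intro measurable_restrict trial_measurable) auto
  then have "(\<lambda>\<omega>. h (restrict (seq \<omega>) {1..s})) \<in> borel_measurable M"
    by (rule measurable_compose) (simp add: measurable_PiM_nat)
  then have "(\<lambda>\<omega>. h (seq \<omega>)) \<in> borel_measurable M"
    by (simp only: bounded_past_restrict[OF assms])
  then show ?thesis
    by (intro integrable_const_bound[of _ B]) (auto simp: B)
qed

text \<open>The index sets \<open>{1..s}\<close> and \<open>{k}\<close> are disjoint, so the
  restrictions of the sequence to them are independent. A set \<open>C\<close> covers both a
  prescribed value and a nonzero trial.\<close>

lemma expectation_next_trial:
  assumes h: "bounded_past s h" and "s < k"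
  shows "expectation (\<lambda>\<omega>. h (seq \<omega>) * of_bool (\<zeta> k \<omega> \<in> C)) =
    expectation (\<lambda>\<omega>. h (seq \<omega>)) * prob {\<omega> \<in> space M. \<zeta> k \<omega> \<in> C}"
proof -
  have "indep_var (PiM {1..s} (\<lambda>_. count_space UNIV)) (\<lambda>\<omega>. restrict (seq \<omega>) {1..s})
      (PiM {k} (\<lambda>_. count_space UNIV)) (\<lambda>\<omega>. restrict (seq \<omega>) {k})"
    by (rule indep_var_restrict[OF indep]) (use \<open>s < k\<close> in auto)
  then have "indep_var borel (h \<circ> (\<lambda>\<omega>. restrict (seq \<omega>) {1..s}))
      borel ((\<lambda>x. of_bool (x k \<in> C) :: real) \<circ> (\<lambda>\<omega>. restrict (seq \<omega>) {k}))"
    by (rule indep_var_compose) (simp_all add: measurable_PiM_nat)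
  then have ind: "indep_var borel (\<lambda>\<omega>. h (seq \<omega>)) borel (\<lambda>\<omega>. of_bool (\<zeta> k \<omega> \<in> C) :: real)"
    unfolding comp_def bounded_past_restrict[OF h] by simp
  have [measurable]: "\<zeta> k \<in> measurable M (count_space UNIV)"
    using trial_measurable \<open>s < k\<close> by simp
  have eq: "(\<lambda>\<omega>. of_bool (\<zeta> k \<omega> \<in> C) :: real) = (\<lambda>\<omega>. indicator {\<omega>. \<zeta> k \<omega> \<in> C} \<omega>)"
    by (auto simp: indicator_def)
  have int: "integrable M (\<lambda>\<omega>. of_bool (\<zeta> k \<omega> \<in> C) :: real)"
    by (intro integrable_const_bound[of _ 1]) (auto)
  have "expectation (\<lambda>\<omega>. of_bool (\<zeta> k \<omega> \<in> C)) = prob {\<omega> \<in> space M. \<zeta> k \<omega> \<in> C}"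
    unfolding eq by (simp add: Collect_conj_eq Int_commute)
  then show ?thesis
    using indep_var_lebesgue_integral[OF ind bounded_past_integrable[OF h] int] by simp
qed

text \<open>The last trial of the run is independent of \<open>h\<close> and of the rest of the run,
  and contributes one factor \<open>w\<close>.\<close>

lemma expectation_run:
  assumes h: "bounded_past s h" and c: "\<And>i. i \<ge> 1 \<Longrightarrow> prob {\<omega> \<in> space M. \<zeta> i \<omega> = c} = w"
  shows "expectation (\<lambda>\<omega>. h (seq \<omega>) * of_bool (\<forall>i\<in>{s<..s + r}. \<zeta> i \<omega> = c)) =
    expectation (\<lambda>\<omega>. h (seq \<omega>)) * w ^ r"
proof (induction r)
  case (Suc r)
  let ?h = "\<lambda>x. h x * of_bool (\<forall>i\<in>{s<..s + r}. x i = c)"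
  have "bounded_past (s + r) ?h"
    by (rule bounded_past_of_bool_mult[OF h]) auto
  note nt = expectation_next_trial[OF this, of "s + Suc r" "{c}"]
  have "{s<..s + Suc r} = insert (s + Suc r) {s<..s + r}" by auto
  then have "expectation (\<lambda>\<omega>. h (seq \<omega>) * of_bool (\<forall>i\<in>{s<..s + Suc r}. \<zeta> i \<omega> = c)) =
      expectation (\<lambda>\<omega>. ?h (seq \<omega>) * of_bool (\<zeta> (s + Suc r) \<omega> \<in> {c}))"
    by (intro Bochner_Integration.integral_cong) auto
  also have "\<dots> = expectation (\<lambda>\<omega>. ?h (seq \<omega>)) * w"
    using nt c by simp
  finally show ?case using Suc by simp
qed simp

text \<open>The trial at \<open>m\<close> belongs to the past on which \<open>h\<close> depends, so
  its indicator stays inside the expectation. The other \<open>l1 - 1\<close> opening zeros, the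
  \<open>r\<close> ones and the closing zero are split off as successive runs.\<close>

lemma expectation_pattern_at:
  assumes h: "bounded_past m h" and "1 \<le> m" "1 \<le> l1"
  shows "expectation (\<lambda>\<omega>. h (seq \<omega>) * of_bool (pattern_at l1 r (seq \<omega>) m (m + l1 + r))) =
    expectation (\<lambda>\<omega>. h (seq \<omega>) * of_bool (\<zeta> m \<omega> = 0)) * q ^ l1 * p ^ r"
proof -
  let ?h0 = "\<lambda>x. h x * of_bool (x m = 0)"
  let ?h1 = "\<lambda>x. ?h0 x * of_bool (\<forall>i\<in>{m<..m + (l1 - 1)}. x i = 0)"
  let ?h2 = "\<lambda>x. ?h1 x * of_bool (\<forall>i\<in>{m + (l1 - 1)<..m + (l1 - 1) + r}. x i = 1)"
  \<comment> \<open>The closing zero is written as a run of length 1, so that it is treated like the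
    other runs.\<close>
  let ?h3 = "\<lambda>x. ?h2 x * of_bool (\<forall>i\<in>{m + (l1 - 1) + r<..m + (l1 - 1) + r + 1}. x i = 0)"
  have h0: "bounded_past m ?h0"
    by (rule bounded_past_of_bool_mult[OF h]) (use \<open>1 \<le> m\<close> in auto)
  have h1: "bounded_past (m + (l1 - 1)) ?h1"
    by (rule bounded_past_of_bool_mult[OF h0]) auto
  have h2: "bounded_past (m + (l1 - 1) + r) ?h2"
    by (rule bounded_past_of_bool_mult[OF h1]) auto
  have iff: "pattern_at l1 r x m (m + l1 + r) \<longleftrightarrow> x m = 0 \<and>
      (\<forall>i\<in>{m<..m + (l1 - 1)}. x i = 0) \<and> (\<forall>i\<in>{m + (l1 - 1)<..m + (l1 - 1) + r}. x i = 1) \<and>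
      (\<forall>i\<in>{m + (l1 - 1) + r<..m + (l1 - 1) + r + 1}. x i = 0)" for x :: "nat \<Rightarrow> nat"
  proof -
    have s: "{m..<m + l1} = insert m {m<..m + (l1 - 1)}"
      "{m + l1..<m + l1 + r} = {m + (l1 - 1)<..m + (l1 - 1) + r}"
      "{m + (l1 - 1) + r<..m + (l1 - 1) + r + 1} = {m + l1 + r}"
      using \<open>1 \<le> l1\<close> by auto
    show ?thesis unfolding pattern_at_def s using \<open>1 \<le> m\<close> by auto
  qed
  have "expectation (\<lambda>\<omega>. h (seq \<omega>) * of_bool (pattern_at l1 r (seq \<omega>) m (m + l1 + r))) =
      expectation (\<lambda>\<omega>. ?h3 (seq \<omega>))"
    unfolding iff of_bool_conj by (simp only: mult.assoc)
  also have "\<dots> = expectation (\<lambda>\<omega>. ?h2 (seq \<omega>)) * q ^ 1"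
    by (rule expectation_run[OF h2 prob_0])
  also have "expectation (\<lambda>\<omega>. ?h2 (seq \<omega>)) = expectation (\<lambda>\<omega>. ?h1 (seq \<omega>)) * p ^ r"
    by (rule expectation_run[OF h1 prob_1])
  also have "expectation (\<lambda>\<omega>. ?h1 (seq \<omega>)) = expectation (\<lambda>\<omega>. ?h0 (seq \<omega>)) * q ^ (l1 - 1)"
    by (rule expectation_run[OF h0 prob_0])
  \<comment> \<open>The closing zero supplies the factor that completes \<open>q ^ (l1 - 1)\<close>
    to \<open>q ^ l1\<close>.\<close>
  finally show ?thesis
    using \<open>1 \<le> l1\<close> by (simp add: power_eq_if[of q l1] mult_ac)
qed

text \<open>Values other than 0 and 1 are excluded only almost surely, so the event is the
  complement of \<open>\<zeta> i \<omega> = 0\<close> and not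
  \<open>\<zeta> i \<omega> = 1\<close>.\<close>

lemma prob_nonzero:
  assumes "i \<ge> 1"
  shows "prob {\<omega> \<in> space M. \<zeta> i \<omega> \<in> - {0}} = p"
proof -
  have [measurable]: "\<zeta> i \<in> measurable M (count_space UNIV)" using trial_measurable assms .
  have "prob {\<omega> \<in> space M. \<not> \<zeta> i \<omega> = 0} = 1 - prob {\<omega> \<in> space M. \<zeta> i \<omega> = 0}"
    by (rule prob_neg) measurable
  then show ?thesis using prob_0[OF assms] q_eq by simp
qed

text \<open>A nonzero trial never completes a pattern, so the count before it may be used instead.\<close>

lemma expectation_zero_trial:
  fixes f :: "nat \<Rightarrow> real"
  assumes "1 \<le> l1" "1 \<le> l2"
  shows "expectation (\<lambda>\<omega>. f (pattern_count l1 l2 k2 (seq \<omega>) (Suc n)) * of_bool (\<zeta> (Suc n) \<omega> = 0)) =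
    expectation (\<lambda>\<omega>. f (pattern_count l1 l2 k2 (seq \<omega>) (Suc n))) -
    p * expectation (\<lambda>\<omega>. f (pattern_count l1 l2 k2 (seq \<omega>) n))"
proof -
  let ?C = "\<lambda>n x. pattern_count l1 l2 k2 x n"
  \<comment> \<open>For a zero trial the subtracted term vanishes; otherwise the two counts agree.
    The indicator now multiplies the count at \<open>n\<close>, which is independent of trial
    \<open>Suc n\<close>.\<close>
  have eq: "f (?C (Suc n) (seq \<omega>)) * of_bool (\<zeta> (Suc n) \<omega> = 0) = f (?C (Suc n) (seq \<omega>)) -
      f (?C n (seq \<omega>)) * of_bool (\<zeta> (Suc n) \<omega> \<in> - {0})" for \<omega>
  proof (cases "\<zeta> (Suc n) \<omega> = 0")
    case False
    have "?C (Suc n) (seq \<omega>) = ?C n (seq \<omega>)"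
    proof (rule pattern_count_constant[OF assms])
      fix e assume "n < e" "e \<le> Suc n" "\<zeta> e \<omega> = 0"
      moreover from this have "e = Suc n" by linarith
      ultimately show "\<zeta> (e - 1) \<omega> \<noteq> 1" using False by blast
    qed simp
    then show ?thesis using False by simp
  qed simp
  have h: "bounded_past (Suc n) (\<lambda>x. f (?C n x) * of_bool (x (Suc n) \<in> - {0}))"
    by (rule bounded_past_of_bool_mult[OF bounded_past_pattern_count]) auto
  have "expectation (\<lambda>\<omega>. f (?C (Suc n) (seq \<omega>)) * of_bool (\<zeta> (Suc n) \<omega> = 0)) =
      expectation (\<lambda>\<omega>. f (?C (Suc n) (seq \<omega>))) -
      expectation (\<lambda>\<omega>. f (?C n (seq \<omega>)) * of_bool (\<zeta> (Suc n) \<omega> \<in> - {0}))"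
    unfolding eq
    by (rule Bochner_Integration.integral_diff[OF
          bounded_past_integrable[OF bounded_past_pattern_count] bounded_past_integrable[OF h]])
  also have "expectation (\<lambda>\<omega>. f (?C n (seq \<omega>)) * of_bool (\<zeta> (Suc n) \<omega> \<in> - {0})) =
      expectation (\<lambda>\<omega>. f (?C n (seq \<omega>))) * prob {\<omega> \<in> space M. \<zeta> (Suc n) \<omega> \<in> - {0}}"
    by (rule expectation_next_trial[OF bounded_past_pattern_count]) simp
  also have "prob {\<omega> \<in> space M. \<zeta> (Suc n) \<omega> \<in> - {0}} = p"
    by (rule prob_nonzero) simp
  finally show ?thesis by (simp only: mult.commute)
qed

section \<open>The recurrence for an arbitrary function of the count\<close>

text \<open>\<open>N\<close> is the start of the shortest possible occurrence ending at
  \<open>Suc n\<close>. \<open>r\<close> is the number of admissible block lengths, limited by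
  \<open>k2\<close> and by the requirement that the start be at least 1.\<close>

lemma expectation_recurrence:
  fixes f :: "nat \<Rightarrow> real" and k2 :: nat
  assumes "1 \<le> l1" "1 \<le> l2" "l1 + l2 \<le> n"
  defines "D \<equiv> \<lambda>s. expectation (\<lambda>\<omega>. f (pattern_count l1 l2 k2 (seq \<omega>) s + 1) -
      f (pattern_count l1 l2 k2 (seq \<omega>) s))"
    and "N \<equiv> Suc n - (l1 + l2)"
    and "r \<equiv> min (k2 - l2 + 1) (Suc n - (l1 + l2))"
  shows "expectation (\<lambda>\<omega>. f (pattern_count l1 l2 k2 (seq \<omega>) (Suc n))) =
    expectation (\<lambda>\<omega>. f (pattern_count l1 l2 k2 (seq \<omega>) n)) +
    q ^ l1 * p ^ l2 * (D N - p ^ r * D (N - r))"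
proof -
  let ?C = "\<lambda>n x. pattern_count l1 l2 k2 x n"
  let ?\<Delta> = "\<lambda>s. f (s + 1) - f s"
  let ?T = "{t. t \<le> k2 - l2 \<and> t + l1 + l2 \<le> n}"
  let ?g = "\<lambda>t x. ?\<Delta> (?C (N - t) x) * of_bool (pattern_at l1 (l2 + t) x (N - t) (Suc n))"
  have T: "?T = {..<r}" unfolding r_def using assms(3) by auto
  \<comment> \<open>This brings the end into the form \<open>m + l1 + r\<close> of
    \<open>expectation_pattern_at\<close>.\<close>
  have end_eq: "Suc n = N - t + l1 + (l2 + t)" if "t < r" for t
    using that assms(3) by (auto simp: N_def r_def)
  have bp: "bounded_past (N - t) (\<lambda>x. ?\<Delta> (?C (N - t) x))" for t
    by (rule bounded_past_pattern_count[where f = ?\<Delta>])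
  have ind: "pattern_at l1 (l2 + t) x (N - t) (Suc n) \<longleftrightarrow>
      pattern_at l1 (l2 + t) y (N - t) (Suc n)" if "\<And>i. i \<in> {1..Suc n} \<Longrightarrow> x i = y i" for t x y
    unfolding pattern_at_def by (intro conj_cong refl ball_cong) (use that in auto)
  have int: "integrable M (\<lambda>\<omega>. ?g t (seq \<omega>))" for t
  proof (rule bounded_past_integrable)
    show "bounded_past (Suc n) (?g t)"
      by (rule bounded_past_of_bool_mult[OF bp[of t] _ ind]) (simp_all add: N_def)
  qed
  have g: "expectation (\<lambda>\<omega>. ?g t (seq \<omega>)) =
      q ^ l1 * p ^ l2 * (p ^ t * (D (N - t) - p * D (N - t - 1)))" if "t < r" for t
  proof -
    \<comment> \<open>The start is positive, hence a successor, as
      \<open>expectation_zero_trial\<close> requires.\<close>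
    have pos: "1 \<le> N - t" using that unfolding r_def N_def by linarith
    then have N: "N - t = Suc (N - t - 1)" by linarith
    have "expectation (\<lambda>\<omega>. ?g t (seq \<omega>)) =
        expectation (\<lambda>\<omega>. ?\<Delta> (?C (N - t) (seq \<omega>)) * of_bool (\<zeta> (N - t) \<omega> = 0)) *
        q ^ l1 * p ^ (l2 + t)"
      by (rule expectation_pattern_at[OF bp[of t] pos assms(1), of "l2 + t", folded end_eq[OF that]])
    also have "expectation (\<lambda>\<omega>. ?\<Delta> (?C (N - t) (seq \<omega>)) * of_bool (\<zeta> (N - t) \<omega> = 0)) =
        D (N - t) - p * D (N - t - 1)"
      unfolding D_def
      by (rule expectation_zero_trial[OF assms(1,2), of ?\<Delta> k2 "N - t - 1", folded N])
    finally show ?thesis by (simp add: power_add mult_ac)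
  qed
  have "expectation (\<lambda>\<omega>. f (?C (Suc n) (seq \<omega>))) - expectation (\<lambda>\<omega>. f (?C n (seq \<omega>))) =
      expectation (\<lambda>\<omega>. f (?C (Suc n) (seq \<omega>)) - f (?C n (seq \<omega>)))"
    by (rule Bochner_Integration.integral_diff[symmetric, OF
          bounded_past_integrable[OF bounded_past_pattern_count]
          bounded_past_integrable[OF bounded_past_pattern_count]])
  also have "\<dots> = expectation (\<lambda>\<omega>. \<Sum>t<r. ?g t (seq \<omega>))"
    unfolding pattern_count_increment[OF assms(1,2)] T
    by (simp add: N_def mult.commute diff_diff_left add_ac)
  also have "\<dots> = (\<Sum>t<r. q ^ l1 * p ^ l2 * (p ^ t * (D (N - t) - p * D (N - t - 1))))"
    unfolding Bochner_Integration.integral_sum[OF int]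
    by (intro sum.cong refl g) simp
  also have "\<dots> = q ^ l1 * p ^ l2 * (D N - p ^ r * D (N - r))"
    unfolding sum_distrib_left[symmetric]
    by (subst sum_power_telescope) (simp_all add: r_def N_def)
  finally show ?thesis by simp
qed

text \<open>One functional of \<open>f\<close> yields all three quantities, so the recurrence is
  proved only once; the value 0 at negative times is their common convention.\<close>

definition pattern_expectation :: "nat \<Rightarrow> nat \<Rightarrow> nat \<Rightarrow> (nat \<Rightarrow> real) \<Rightarrow> int \<Rightarrow> real" where
  "pattern_expectation l1 l2 k2 f n =
     (if n < 0 then 0 else expectation (\<lambda>\<omega>. f (pattern_count l1 l2 k2 (seq \<omega>) (nat n))))"

lemma pattern_expectation_neg: "n < 0 \<Longrightarrow> pattern_expectation l1 l2 k2 f n = 0"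
  by (simp add: pattern_expectation_def)

lemma pattern_expectation_init:
  assumes "0 \<le> n" "n \<le> int (l1 + l2)"
  shows "pattern_expectation l1 l2 k2 f n = f 0"
  using assms pattern_count_eq_0[of "nat n" l1 l2 k2]
  by (simp add: pattern_expectation_def prob_space nat_le_iff)

text \<open>The number of summands is \<open>m2\<close> unless the sum is cut off at start 1. In the
  latter case \<open>G\<close> is 0 at the negative time, and the indicator term accounts for the
  boundary value that remains.\<close>

lemma pattern_expectation_recurrence:
  fixes f :: "nat \<Rightarrow> real" and k2 :: nat
  assumes "1 \<le> l1" "1 \<le> l2" "L = l1 + l2" "m2 = k2 - l2 + 1" "n \<ge> int L + 1"
  defines "F \<equiv> pattern_expectation l1 l2 k2 f"
    and "G \<equiv> pattern_expectation l1 l2 k2 (\<lambda>s. f (s + 1) - f s)"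
  shows "F n = F (n - 1) + q ^ l1 * p ^ l2 * (G (n - int L) - p ^ m2 * G (n - int L - int m2)) -
    q ^ l1 * p ^ l2 * p ^ nat (n - int L) * (f 1 - f 0) *
      of_bool (int L + 1 \<le> n \<and> n \<le> int L + int m2 - 1)"
proof -
  define k where "k = nat (n - 1)"
  have n: "n = int (Suc k)" "n - 1 = int k" and k: "l1 + l2 \<le> k" using assms by (auto simp: k_def)
  define N where "N = Suc k - L"
  have N: "n - int L = int N" using k n by (simp add: N_def assms(3))
  define D where "D = (\<lambda>s. expectation (\<lambda>\<omega>. f (pattern_count l1 l2 k2 (seq \<omega>) s + 1) -
      f (pattern_count l1 l2 k2 (seq \<omega>) s)))"
  have G: "G (int s) = D s" for s
    by (simp add: G_def D_def pattern_expectation_def)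
  have "F n = F (n - 1) + q ^ l1 * p ^ l2 * (D N - p ^ min m2 N * D (N - min m2 N))"
    using expectation_recurrence[OF assms(1,2) k, of f k2]
    unfolding F_def n(2) unfolding n(1) pattern_expectation_def N_def assms(3,4) D_def
    by (simp del: of_nat_Suc)
  moreover have "D N = G (n - int L)" using N G by simp
  moreover have "p ^ min m2 N * D (N - min m2 N) = p ^ m2 * G (n - int L - int m2) +
      p ^ nat (n - int L) * (f 1 - f 0) * of_bool (int L + 1 \<le> n \<and> n \<le> int L + int m2 - 1)"
  proof (cases "m2 \<le> N")
    case True
    then have "n - int L - int m2 = int (N - m2)" using N by simp
    then have "G (n - int L - int m2) = D (N - m2)" by (simp only: G)
    then show ?thesis using True N by simp
  next
    case False
    \<comment> \<open>At time 0 nothing has been counted, so the expected difference is a fixed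
      number.\<close>
    have "D 0 = f 1 - f 0" using G[of 0] by (simp add: G_def pattern_expectation_init)
    moreover have "G (n - int L - int m2) = 0"
      using False N by (simp add: G_def pattern_expectation_neg)
    ultimately show ?thesis using False N assms(5) by simp
  qed
  ultimately show ?thesis by (simp add: algebra_simps)
qed

lemma pattern_expectation_cmult:
  "pattern_expectation l1 l2 k2 (\<lambda>s. c * f s) n = c * pattern_expectation l1 l2 k2 f n"
  by (simp add: pattern_expectation_def)

lemma pattern_expectation_diff:
  "pattern_expectation l1 l2 k2 (\<lambda>s. f s - g s) n =
    pattern_expectation l1 l2 k2 f n - pattern_expectation l1 l2 k2 g n"
  by (simp add: pattern_expectation_def Bochner_Integration.integral_diff
      bounded_past_integrable[OF bounded_past_pattern_count])

lemma pattern_expectation_sum: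
  "pattern_expectation l1 l2 k2 (\<lambda>s. \<Sum>k\<in>A. f k s) n =
    (\<Sum>k\<in>A. pattern_expectation l1 l2 k2 (f k) n)"
  by (simp add: pattern_expectation_def Bochner_Integration.integral_sum
      bounded_past_integrable[OF bounded_past_pattern_count])

section \<open>Generating function, probabilities and moments\<close>

lemma pattern_pgf_eq: "pattern_pgf M \<zeta> l1 l2 k2 n t = pattern_expectation l1 l2 k2 (\<lambda>s. t ^ s) n"
  by (simp add: pattern_pgf_def pattern_expectation_def)

lemma pattern_moment_eq:
  "pattern_moment M \<zeta> l1 l2 k2 n j = pattern_expectation l1 l2 k2 (\<lambda>s. real s ^ j) n"
  by (simp add: pattern_moment_def pattern_expectation_def)

lemma pattern_prob_eq:
  "pattern_prob M \<zeta> l1 l2 k2 m n = pattern_expectation l1 l2 k2 (\<lambda>s. of_bool (int s = m)) n"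
proof -
  have "(\<lambda>\<omega>. of_bool (int (pattern_count l1 l2 k2 (seq \<omega>) (nat n)) = m) :: real) =
      (\<lambda>\<omega>. indicator {\<omega>. int (pattern_count l1 l2 k2 (seq \<omega>) (nat n)) = m} \<omega>)"
    by (auto simp: indicator_def)
  then show ?thesis
    by (simp add: pattern_prob_def pattern_expectation_def Collect_conj_eq Int_commute)
qed

end

text \<open>Subtraction removes the top term of the binomial expansion, leaving exponents up to
  \<open>j - 1\<close>.\<close>

lemma power_increment:
  fixes x :: "'a :: comm_ring_1"
  assumes "1 \<le> j"
  shows "(x + 1) ^ j - x ^ j = (\<Sum>k = 0..j - 1. of_nat (j choose k) * x ^ k)"
proof -
  obtain i where "j = Suc i" using assms by (cases j) auto
  then show ?thesis
    unfolding binomial_ring by (simp add: atLeast0AtMost del: power_Suc binomial_Suc_Suc)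
qed

theorem theorem2p4:
  fixes M :: "'a measure" and \<zeta> :: "nat \<Rightarrow> 'a \<Rightarrow> nat"
    and l1 l2 k2 L m2 :: nat and p q a :: real
    and \<phi> :: "int \<Rightarrow> real \<Rightarrow> real" and P :: "int \<Rightarrow> int \<Rightarrow> real" and \<mu> :: "int \<Rightarrow> nat \<Rightarrow> real"
  assumes "prob_space M"
    and "prob_space.indep_vars M (\<lambda>_. count_space UNIV) \<zeta> {1..}"
    and "0 \<le> p" and "p \<le> 1" and "q = 1 - p"
    and "\<And>i. i \<ge> 1 \<Longrightarrow> measure M {\<omega> \<in> space M. \<zeta> i \<omega> = 1} = p"
    and "\<And>i. i \<ge> 1 \<Longrightarrow> measure M {\<omega> \<in> space M. \<zeta> i \<omega> = 0} = q"
    and "1 \<le> l1" and "1 \<le> l2" and "l2 \<le> k2"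
    and "a = q ^ l1 * p ^ l2" and "L = l1 + l2" and "m2 = k2 - l2 + 1"
    and "\<phi> = pattern_pgf M \<zeta> l1 l2 k2"
    and "P = pattern_prob M \<zeta> l1 l2 k2"
    and "\<mu> = pattern_moment M \<zeta> l1 l2 k2"
  shows
    "((\<forall>n \<ge> int L + 1. \<forall>t.
         \<phi> n t = \<phi> (n - 1) t
           + a * (t - 1) * (\<phi> (n - int L) t - p ^ m2 * \<phi> (n - int L - int m2) t)
           - a * (t - 1) * p ^ nat (n - int L)
               * of_bool (int L + 1 \<le> n \<and> n \<le> int L + int m2 - 1))
      \<and> (\<forall>n t. 0 \<le> n \<and> n \<le> int L \<longrightarrow> \<phi> n t = 1)
      \<and> (\<forall>n t. n < 0 \<longrightarrow> \<phi> n t = 0))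
     \<and>
     ((\<forall>n \<ge> int L + 1. \<forall>m \<ge> 0.
         P m n = P m (n - 1)
           + a * (P (m - 1) (n - int L) - P m (n - int L)
                  - p ^ m2 * (P (m - 1) (n - int L - int m2) - P m (n - int L - int m2)))
           - a * p ^ nat (n - int L)
               * (of_bool (m = 1 \<and> int L + 1 \<le> n \<and> n \<le> int L + int m2 - 1)
                  - of_bool (m = 0 \<and> int L + 1 \<le> n \<and> n \<le> int L + int m2 - 1)))
      \<and> (\<forall>n. 0 \<le> n \<and> n \<le> int L \<longrightarrow> P 0 n = 1)
      \<and> (\<forall>m n. m > 0 \<and> 0 \<le> n \<and> n \<le> int L \<longrightarrow> P m n = 0)
      \<and> (\<forall>m n. n < 0 \<or> m < 0 \<longrightarrow> P m n = 0))
     \<and>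
     ((\<forall>n \<ge> int L + 1. \<forall>j \<ge> 1.
         \<mu> n j = \<mu> (n - 1) j
           + a * (\<Sum>k = 0..j - 1. real (j choose k)
                    * (\<mu> (n - int L) k - p ^ m2 * \<mu> (n - int L - int m2) k))
           - a * p ^ nat (n - int L)
               * of_bool (int L + 1 \<le> n \<and> n \<le> int L + int m2 - 1))
      \<and> (\<forall>n \<ge> 0. \<mu> n 0 = 1)
      \<and> (\<forall>j \<ge> 1. \<forall>n. 0 \<le> n \<and> n \<le> int L \<longrightarrow> \<mu> n j = 0)
      \<and> (\<forall>n j. n < 0 \<longrightarrow> \<mu> n j = 0))"
proof -
  interpret prob_space M by fact
  interpret bernoulli_trials M \<zeta> p q
    by unfold_locales (use assms in auto)
  let ?F = "pattern_expectation l1 l2 k2"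
  have \<phi>: "\<phi> n t = ?F (\<lambda>s. t ^ s) n" for n t
    by (simp add: \<open>\<phi> = _\<close> pattern_pgf_eq)
  have P: "P m n = ?F (\<lambda>s. of_bool (int s = m)) n" for m n
    by (simp add: \<open>P = _\<close> pattern_prob_eq)
  have \<mu>: "\<mu> n j = ?F (\<lambda>s. real s ^ j) n" for n j
    by (simp add: \<open>\<mu> = _\<close> pattern_moment_eq)
  note rec = pattern_expectation_recurrence[OF \<open>1 \<le> l1\<close> \<open>1 \<le> l2\<close> \<open>L = l1 + l2\<close>
      \<open>m2 = k2 - l2 + 1\<close>, folded \<open>a = q ^ l1 * p ^ l2\<close>]
  note init = pattern_expectation_init[of _ l1 l2, folded \<open>L = l1 + l2\<close>]
  have pgf: "\<phi> n t = \<phi> (n - 1) t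
           + a * (t - 1) * (\<phi> (n - int L) t - p ^ m2 * \<phi> (n - int L - int m2) t)
           - a * (t - 1) * p ^ nat (n - int L)
               * of_bool (int L + 1 \<le> n \<and> n \<le> int L + int m2 - 1)" if "n \<ge> int L + 1" for n t
  proof -
    \<comment> \<open>The difference of a geometric sequence is a multiple of that sequence, so the
      recurrence closes on \<open>\<phi>\<close>; the boundary factor \<open>f 1 - f 0\<close> is
      \<open>t - 1\<close>.\<close>
    have "(\<lambda>s. t ^ (s + 1) - t ^ s) = (\<lambda>s. (t - 1) * t ^ s)"
      by (simp add: fun_eq_iff algebra_simps)
    then have \<Delta>: "?F (\<lambda>s. t ^ (s + 1) - t ^ s) n = (t - 1) * \<phi> n t" for n
      by (simp only: pattern_expectation_cmult \<phi>)
    show ?thesis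
      using rec[OF that, of "\<lambda>s. t ^ s"] unfolding \<Delta> \<phi>[symmetric] by (simp add: algebra_simps)
  qed
  have pmf: "P m n = P m (n - 1)
           + a * (P (m - 1) (n - int L) - P m (n - int L)
                  - p ^ m2 * (P (m - 1) (n - int L - int m2) - P m (n - int L - int m2)))
           - a * p ^ nat (n - int L)
               * (of_bool (m = 1 \<and> int L + 1 \<le> n \<and> n \<le> int L + int m2 - 1)
                  - of_bool (m = 0 \<and> int L + 1 \<le> n \<and> n \<le> int L + int m2 - 1))"
    if "n \<ge> int L + 1" for n m
  proof -
    \<comment> \<open>For \<open>m = 0\<close> neither equation can hold, in accordance with
      probability 0 at the value -1.\<close>
    have shift: "of_bool (int (s + 1) = m) = (of_bool (int s = m - 1) :: real)" for s
      by auto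
    have \<Delta>: "?F (\<lambda>s. of_bool (int (s + 1) = m) - of_bool (int s = m)) n = P (m - 1) n - P m n" for n
      unfolding shift pattern_expectation_diff P ..
    show ?thesis
      using rec[OF that, of "\<lambda>s. of_bool (int s = m)"] unfolding \<Delta> P[symmetric]
      by (auto simp: algebra_simps)
  qed
  have mom: "\<mu> n j = \<mu> (n - 1) j
           + a * (\<Sum>k = 0..j - 1. real (j choose k)
                    * (\<mu> (n - int L) k - p ^ m2 * \<mu> (n - int L - int m2) k))
           - a * p ^ nat (n - int L)
               * of_bool (int L + 1 \<le> n \<and> n \<le> int L + int m2 - 1)"
    if "n \<ge> int L + 1" "j \<ge> 1" for n j
  proof -
    have "(\<lambda>s. real (s + 1) ^ j - real s ^ j) =
        (\<lambda>s. \<Sum>k = 0..j - 1. real (j choose k) * real s ^ k)"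
      using power_increment[OF \<open>j \<ge> 1\<close>, of "real s" for s] by (simp add: fun_eq_iff add.commute)
    then have \<Delta>: "?F (\<lambda>s. real (s + 1) ^ j - real s ^ j) n =
        (\<Sum>k = 0..j - 1. real (j choose k) * \<mu> n k)" for n
      by (simp only: pattern_expectation_sum pattern_expectation_cmult \<mu>)
    \<comment> \<open>For \<open>j \<ge> 1\<close> the boundary factor \<open>f 1 - f 0\<close> is
      \<open>1 - 0 ^ j = 1\<close>.\<close>
    show ?thesis
      using rec[OF that(1), of "\<lambda>s. real s ^ j"] that(2) unfolding \<Delta> \<mu>[symmetric]
      by (simp add: right_diff_distrib sum_subtractf sum_distrib_left mult_ac power_0_left)
  qed
  \<comment> \<open>With exponent 0 the power is 1 even where the count is 0.\<close>
  have "?F (\<lambda>s. real s ^ 0) n = 1" if "n \<ge> 0" for n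
    using that by (simp add: pattern_expectation_def prob_space)
  moreover have "P m n = 0" if "m < 0" for m n
  proof -
    have "(\<lambda>s. of_bool (int s = m)) = (\<lambda>_. 0 :: real)" using that by auto
    then show ?thesis by (simp add: P pattern_expectation_def)
  qed
  ultimately show ?thesis
    using pgf pmf mom init pattern_expectation_neg unfolding \<phi> P \<mu> by auto
qed

end
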